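(* 1. (Even case.) Let $N\ge1$ be an integer and $W^{\sqrt{2N}}=\bigcup_{j\in\mathbb{Z}}W_j^{\sqrt{2N}}$, where $W_j^{\sqrt{2N}}=\mathbb{C}[e_i\mid i\in\mathbb{Z}]\,|j\sqrt{2N}\rangle$. Then $W^{\sqrt{2N}}$ is invariant under the modes $a_n$, $n\in\mathbb{Z}$, of $a(z)$. In particular, $W^{\sqrt{2N}}=V_{\sqrt{2N}\,\mathbb{Z}}$. 2. (Odd case.) Let $N\ge0$ be an integer and $W^{\sqrt{2N+1}}=\bigcup_{j\in\mathbb{Z}}W_j^{\sqrt{2N+1}}$, where $W_j^{\sqrt{2N+1}}=\mathbb{C}\{\theta_i\mid i\in\mathbb{Z}\}\,|j\sqrt{2N+1}\rangle$. Then $W^{\sqrt{2N+1}}$ is invariant under the modes $a_n$, $n\in\mathbb{Z}$, of $a(z)$. In particular, $W^{\sqrt{2N+1}}=V_{\sqrt{2N+1}\,\mathbb{Z}}$.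
   Context: **Lattice vertex superalgebra.** The Heisenberg Lie algebra is $\mathfrak{H}=\langle C, a_n \mid n\in\mathbb{Z}\rangle_{\mathbb{C}}$ with $[a_n,a_m]=n\,\delta_{n+m,0}\,C$ and $C$ central; $a(z)=\sum_{n\in\mathbb Z}a_nz^{-n-1}$. $F_\mu$ is the Fock module with highest weight vector $|\mu\rangle$: $C$ acts by $1$, $a_0|\mu\rangle=\mu|\mu\rangle$, $a_n|\mu\rangle=0$ for $n>0$, and $F_\mu$ is freely generated from $|\mu\rangle$ by the $a_{n}$, $n<0$. For a positive integer $M$, $V_{\sqrt{M}\,\mathbb{Z}}=\bigoplus_{\mu\in\sqrt{M}\,\mathbb{Z}}F_\mu$, with vertex operators ($\mu\in\sqrt M\,\mathbb{Z}$) $$V_\mu(z)=e^{\mu q}\,z^{\mu a_0}\exp\Big(-\mu\sum_{n<0}\frac{a_n}{n}z^{-n}\Big)\exp\Big(-\mu\sum_{n>0}\frac{a_n}{n}z^{-n}\Big),$$ where $[a_0,q]=1$, $[a_n,q]=0$ for $n\neq0$, so $e^{\mu q}$ commutes with $a_n$ ($n\ne 0$) and $e^{\mu q}|\lambda\rangle=|\lambda+\mu\rangle$. **Modes.** For $M=2N$: $V_{\sqrt{2N}}(z)=e(z)=\sum_{n\in\mathbb{Z}}e_n z^{-n-N}$; the $e_n$ commute with each other. For $M=2N+1$: $V_{\sqrt{2N+1}}(z)=\theta(z)=\sum_{n\in\mathbb{Z}}\theta_n z^{-n}$; the $\theta_n$ anticommute with each other. **Basic subspaces.** $\mathbb{C}[e_i\mid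 i\in\mathbb{Z}]\,|j\sqrt{2N}\rangle$ is the linear span of all vectors $e_{i_1}\cdots e_{i_k}|j\sqrt{2N}\rangle$, $k\ge0$; $\mathbb{C}\{\theta_i\mid i\in\mathbb{Z}\}\,|j\sqrt{2N+1}\rangle$ is the linear span of all vectors $\theta_{i_1}\cdots\theta_{i_k}|j\sqrt{2N+1}\rangle$, $k\ge0$. *)

theory Defs
  imports Complex_Main "HOL-Library.Poly_Mapping" "HOL-Library.Product_Plus"
begin

section \<open>Fock modules of the Heisenberg algebra\<close>

text \<open>
  A monomial \<open>m\<close> stands for the product of the creation operators \<open>a\<^sub>-\<^sub>(\<^sub>i\<^sub>+\<^sub>1\<^sub>)\<close>, each to the
  power \<open>Poly_Mapping.lookup m i\<close>; the shift by one makes every \<open>i :: nat\<close> a legitimate index. The pair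
  \<open>(\<mu>, m)\<close> labels the basis vector obtained by applying that product to the highest weight
  vector of charge \<open>\<mu>\<close>, so the type \<open>fock\<close> is the direct sum of the Fock modules of all real
  charges. Lattice charges are kept as actual reals \<open>j * sqrt M\<close>.
\<close>

type_synonym label = "real \<times> (nat \<Rightarrow>\<^sub>0 nat)"
type_synonym fock = "label \<Rightarrow>\<^sub>0 complex"

definition scl :: "complex \<Rightarrow> fock \<Rightarrow> fock" where
  "scl c v = Poly_Mapping.map ((*) c) v"

lemma lookup_scl [simp]: "Poly_Mapping.lookup (scl c v) b = c * Poly_Mapping.lookup v b"
  by (simp add: scl_def Poly_Mapping.map.rep_eq when_def)

interpretation fock: vector_space scl
  by unfold_locales (auto intro!: poly_mapping_eqI simp: lookup_add algebra_simps)

definition basis :: "label \<Rightarrow> fock" where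
  "basis b = Poly_Mapping.single b 1"

definition lin_ext :: "(label \<Rightarrow> fock) \<Rightarrow> fock \<Rightarrow> fock" where
  "lin_ext f v = (\<Sum>b\<in>Poly_Mapping.keys v. scl (Poly_Mapping.lookup v b) (f b))"

definition ket :: "real \<Rightarrow> fock" where
  "ket \<mu> = basis (\<mu>, 0)"

definition var :: "int \<Rightarrow> nat \<Rightarrow>\<^sub>0 nat" where
  "var n = Poly_Mapping.single (nat n - 1) 1"

text \<open>
  \<open>a_mode n\<close> is the operator \<open>a\<^sub>n\<close>: multiplication by the creation variable for \<open>n < 0\<close>, the
  charge for \<open>n = 0\<close>, and \<open>n\<close> times the derivative in the variable \<open>a\<^sub>-\<^sub>n\<close> for \<open>n > 0\<close>. The truncated
  subtraction of exponents is harmless, since the coefficient vanishes whenever it truncates.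
\<close>

definition a_basis :: "int \<Rightarrow> label \<Rightarrow> fock" where
  "a_basis n b = (case b of (\<mu>, m) \<Rightarrow>
     if n < 0 then basis (\<mu>, m + var (- n))
     else if n = 0 then scl (of_real \<mu>) (basis (\<mu>, m))
     else scl (of_int n * of_nat (Poly_Mapping.lookup m (nat n - 1))) (basis (\<mu>, m - var n)))"

definition a_mode :: "int \<Rightarrow> fock \<Rightarrow> fock" where
  "a_mode n = lin_ext (a_basis n)"

definition Fock :: "real \<Rightarrow> fock set" where
  "Fock \<mu> = {v. \<forall>b\<in>Poly_Mapping.keys v. fst b = \<mu>}"

definition lattice_space :: "nat \<Rightarrow> fock set" where
  "lattice_space M = fock.span (\<Union>j::int. Fock (of_int j * sqrt (of_nat M)))"


section \<open>Vertex operators\<close>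

definition exp_q :: "real \<Rightarrow> fock \<Rightarrow> fock" where
  "exp_q \<mu> = lin_ext (\<lambda>(\<nu>, m). basis (\<nu> + \<mu>, m))"

text \<open>\<open>z_pow \<mu> p\<close> is the coefficient of \<open>z\<^sup>p\<close> in the operator that multiplies vectors of
  charge \<open>\<nu>\<close> by \<open>z\<close> to the power \<open>\<mu> * \<nu>\<close>.\<close>

definition z_pow :: "real \<Rightarrow> real \<Rightarrow> fock \<Rightarrow> fock" where
  "z_pow \<mu> p = lin_ext (\<lambda>(\<nu>, m). if \<mu> * \<nu> = p then basis (\<nu>, m) else 0)"

text \<open>Formal power series in one variable with operator coefficients.\<close>

type_synonym op_series = "nat \<Rightarrow> fock \<Rightarrow> fock"

definition series_mult :: "op_series \<Rightarrow> op_series \<Rightarrow> op_series" where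
  "series_mult A B k v = (\<Sum>i\<le>k. A i (B (k - i) v))"

primrec series_power :: "op_series \<Rightarrow> nat \<Rightarrow> op_series" where
  "series_power X 0 = (\<lambda>k v. if k = 0 then v else 0)"
| "series_power X (Suc r) = series_mult X (series_power X r)"

text \<open>The exponential of a series without constant term: its \<open>r\<close>-th power has no coefficient
  in degree \<open>k < r\<close>, so the exponential sum may stop at \<open>r = k\<close>.\<close>

definition series_exp :: "op_series \<Rightarrow> op_series" where
  "series_exp X k v = (\<Sum>r\<le>k. scl (1 / fact r) (series_power X r k v))"

text \<open>The arguments of the two exponentials of the vertex operator. In \<open>create_series\<close> the
  index \<open>k\<close> is the exponent of \<open>z\<close>, in \<open>annih_series\<close> that of the inverse of \<open>z\<close>; thus \<open>k\<close>
  belongs to the summation index \<open>n = - k\<close>, respectively \<open>n = k\<close>, in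
  \<open>- \<mu> * (\<Sum>n. a\<^sub>n / n * z powi (- n))\<close>.\<close>

definition create_series :: "real \<Rightarrow> op_series" where
  "create_series \<mu> k v =
     (if k = 0 then 0 else scl (- of_real \<mu> / of_int (- int k)) (a_mode (- int k) v))"

definition annih_series :: "real \<Rightarrow> op_series" where
  "annih_series \<mu> k v =
     (if k = 0 then 0 else scl (- of_real \<mu> / of_int (int k)) (a_mode (int k) v))"

text \<open>\<open>vertex_coeff \<mu> p\<close> is the coefficient of \<open>z\<^sup>p\<close> in the vertex operator of charge \<open>\<mu>\<close>. The sum
  over \<open>(k, l)\<close> has only finitely many nonzero terms on each vector, see
  \<open>vertex_coeff_finite\<close> below.\<close>

definition vertex_term :: "real \<Rightarrow> real \<Rightarrow> fock \<Rightarrow> nat \<times> nat \<Rightarrow> fock" where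
  "vertex_term \<mu> p v = (\<lambda>(k, l). exp_q \<mu> (z_pow \<mu> (p - real k + real l)
     (series_exp (create_series \<mu>) k (series_exp (annih_series \<mu>) l v))))"

definition vertex_coeff :: "real \<Rightarrow> real \<Rightarrow> fock \<Rightarrow> fock" where
  "vertex_coeff \<mu> p v = Sum_any (vertex_term \<mu> p v)"

definition e_mode :: "nat \<Rightarrow> int \<Rightarrow> fock \<Rightarrow> fock" where
  "e_mode N n = vertex_coeff (sqrt (of_nat (2 * N))) (of_int (- n - int N))"

definition theta_mode :: "nat \<Rightarrow> int \<Rightarrow> fock \<Rightarrow> fock" where
  "theta_mode N n = vertex_coeff (sqrt (of_nat (2 * N + 1))) (of_int (- n))"


section \<open>Basic subspaces\<close>

definition generated :: "(int \<Rightarrow> fock \<Rightarrow> fock) \<Rightarrow> fock \<Rightarrow> fock set" where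
  "generated E v = fock.span (range (\<lambda>is. foldr E is v))"

definition W_even :: "nat \<Rightarrow> fock set" where
  "W_even N = (\<Union>j::int. generated (e_mode N) (ket (of_int j * sqrt (of_nat (2 * N)))))"

definition W_odd :: "nat \<Rightarrow> fock set" where
  "W_odd N = (\<Union>j::int. generated (theta_mode N) (ket (of_int j * sqrt (of_nat (2 * N + 1)))))"


section \<open>The defining relations hold\<close>

lemma fock_expand: "v = (\<Sum>b\<in>Poly_Mapping.keys v. scl (Poly_Mapping.lookup v b) (basis b))"
proof (rule poly_mapping_eqI)
  fix c
  have "Poly_Mapping.lookup (\<Sum>b\<in>Poly_Mapping.keys v. scl (Poly_Mapping.lookup v b) (basis b)) c
      = (\<Sum>b\<in>Poly_Mapping.keys v. if b = c then Poly_Mapping.lookup v b else 0)"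
    unfolding lookup_sum
    by (rule sum.cong) (auto simp: basis_def lookup_single when_def)
  also have "\<dots> = Poly_Mapping.lookup v c"
    by (auto simp: sum.delta in_keys_iff)
  finally show "Poly_Mapping.lookup v c = Poly_Mapping.lookup (\<Sum>b\<in>Poly_Mapping.keys v. scl (Poly_Mapping.lookup v b) (basis b)) c" ..
qed

abbreviation linear_op :: "(fock \<Rightarrow> fock) \<Rightarrow> bool" where
  "linear_op \<equiv> Vector_Spaces.linear scl scl"

lemma linear_opI:
  assumes "\<And>x y. f (x + y) = f x + f y" "\<And>c x. f (scl c x) = scl c (f x)"
  shows "linear_op f"
  using assms by unfold_locales

lemma linear_opD:
  assumes "linear_op f"
  shows "f (x + y) = f x + f y" "f (scl c x) = scl c (f x)" "f 0 = 0" "f (sum g A) = (\<Sum>a\<in>A. f (g a))"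
proof -
  interpret l: Vector_Spaces.linear scl scl f by (rule assms)
  show "f (x + y) = f x + f y" "f (scl c x) = scl c (f x)" "f 0 = 0" "f (sum g A) = (\<Sum>a\<in>A. f (g a))"
    by (rule l.add l.scale l.zero l.sum)+
qed

lemma lin_ext_superset:
  assumes "finite A" "Poly_Mapping.keys v \<subseteq> A"
  shows "lin_ext f v = (\<Sum>b\<in>A. scl (Poly_Mapping.lookup v b) (f b))"
  unfolding lin_ext_def using assms
  by (intro sum.mono_neutral_left) (auto simp: in_keys_iff)

lemma linear_lin_ext: "linear_op (lin_ext f)"
proof (rule linear_opI)
  fix x y :: fock
  let ?A = "Poly_Mapping.keys x \<union> Poly_Mapping.keys y"
  have "Poly_Mapping.keys (x + y) \<subseteq> ?A" by (rule keys_add)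
  then show "lin_ext f (x + y) = lin_ext f x + lin_ext f y"
    by (subst (1 2 3) lin_ext_superset[of ?A])
       (auto simp: lookup_add fock.scale_left_distrib sum.distrib)
next
  fix c and x :: fock
  have "Poly_Mapping.keys (scl c x) \<subseteq> Poly_Mapping.keys x"
    by (auto simp: in_keys_iff)
  then show "lin_ext f (scl c x) = scl c (lin_ext f x)"
    by (subst (1 2) lin_ext_superset[of "Poly_Mapping.keys x"])
       (auto simp: fock.scale_sum_right)
qed

lemma lin_ext_basis [simp]: "lin_ext f (basis b) = f b"
  by (simp add: lin_ext_def basis_def)

lemma linear_op_eqI:
  assumes "linear_op f" "linear_op g" "\<And>b. f (basis b) = g (basis b)"
  shows "f v = g v"
  by (subst (1 2) fock_expand) (simp add: assms(3) linear_opD[OF assms(1)] linear_opD[OF assms(2)])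

lemma linear_a_mode: "linear_op (a_mode n)"
  by (simp add: a_mode_def linear_lin_ext)

lemma linear_exp_q: "linear_op (exp_q \<mu>)"
  by (simp add: exp_q_def linear_lin_ext)

lemma a_mode_basis: "a_mode n (basis b) = a_basis n b"
  by (simp add: a_mode_def)

lemma a_mode_zero_ket: "a_mode 0 (ket \<mu>) = scl (of_real \<mu>) (ket \<mu>)"
  by (simp add: ket_def a_mode_basis a_basis_def)

lemma a_mode_pos_ket: "n > 0 \<Longrightarrow> a_mode n (ket \<mu>) = 0"
  by (simp add: ket_def a_mode_basis a_basis_def)

lemma exp_q_ket: "exp_q \<mu> (ket \<nu>) = ket (\<nu> + \<mu>)"
  by (simp add: ket_def exp_q_def)

lemma exp_q_commute:
  assumes "n \<noteq> 0"
  shows "exp_q \<mu> (a_mode n v) = a_mode n (exp_q \<mu> v)"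
proof (rule linear_op_eqI[of "\<lambda>v. exp_q \<mu> (a_mode n v)" "\<lambda>v. a_mode n (exp_q \<mu> v)"])
  show "linear_op (\<lambda>v. exp_q \<mu> (a_mode n v))" "linear_op (\<lambda>v. a_mode n (exp_q \<mu> v))"
    by (rule linear_opI; simp add: linear_opD[OF linear_exp_q] linear_opD[OF linear_a_mode])+
  fix b
  show "exp_q \<mu> (a_mode n (basis b)) = a_mode n (exp_q \<mu> (basis b))"
    using assms
    by (cases b) (simp add: a_mode_basis a_basis_def linear_opD[OF linear_exp_q] exp_q_def
        linear_opD[OF linear_lin_ext])
qed

lemma heisenberg_relation:
  "a_mode n (a_mode m v) - a_mode m (a_mode n v) = (if n + m = 0 then scl (of_int n) v else 0)"
  (is "?l v = ?r v")
proof (rule linear_op_eqI[of ?l ?r])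
  show "linear_op ?l"
    by (rule linear_opI) (simp_all add: linear_opD[OF linear_a_mode] fock.scale_right_diff_distrib)
  show "linear_op ?r"
    by (rule linear_opI) (simp_all add: fock.scale_right_distrib mult.commute)
  fix b
  show "?l (basis b) = ?r (basis b)"
  proof (cases b)
    case (Pair \<mu> w)
    have minus_add: "w - var i + var j = w + var j - var i"
      if "i \<noteq> j" "i > 0" "j > 0" for i j :: int
      using that by (intro poly_mapping_eqI) (auto simp: var_def lookup_add lookup_minus lookup_single when_def)
    have minus_add': "w - var i + var i = w" if "Poly_Mapping.lookup w (nat i - 1) \<noteq> 0" for i :: int
      using that by (intro poly_mapping_eqI) (auto simp: var_def lookup_add lookup_minus lookup_single when_def)
    have lookup_var: "Poly_Mapping.lookup (var i) (nat j - Suc 0) = (if i = j then 1 else 0)" if "i > 0" "j > 0" for i j :: int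
      using that by (auto simp: var_def lookup_single when_def)
    have minus_minus: "w - var i - var j = w - var j - var i" for i j :: int
      by (intro poly_mapping_eqI) (auto simp: lookup_minus)
    note lin = linear_opD[OF linear_a_mode]
    consider "n < 0" "m < 0" | "n = 0" | "m = 0" | "n > 0" "m > 0" | "n < 0" "m > 0" | "n > 0" "m < 0"
      by linarith
    then show ?thesis
    proof cases
      case 4
      then show ?thesis
        by (auto simp: Pair a_mode_basis a_basis_def lin lookup_minus lookup_var minus_minus[of n m])
    next
      case 5
      show ?thesis
      proof (cases "n + m = 0")
        case True
        then have [simp]: "n = - m" by simp
        show ?thesis
        proof (cases "Poly_Mapping.lookup w (nat m - 1) = 0")
          case z: True
          show ?thesis using 5 z
            by (auto simp: Pair a_mode_basis a_basis_def lin lookup_add lookup_var algebra_simps)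
        next
          case False
          show ?thesis using 5 minus_add'[OF False]
            by (auto simp: Pair a_mode_basis a_basis_def lin lookup_add lookup_var algebra_simps
                intro!: poly_mapping_eqI simp: lookup_minus)
        qed
      next
        case False
        then show ?thesis using 5 minus_add[of m "-n"]
          by (auto simp: Pair a_mode_basis a_basis_def lin lookup_add lookup_var)
      qed
    next
      case 6
      show ?thesis
      proof (cases "n + m = 0")
        case True
        then have [simp]: "m = - n" by simp
        show ?thesis
        proof (cases "Poly_Mapping.lookup w (nat n - 1) = 0")
          case z: True
          show ?thesis using 6 z
            by (auto simp: Pair a_mode_basis a_basis_def lin lookup_add lookup_var algebra_simps)
        next
          case False
          show ?thesis using 6 minus_add'[OF False]
            by (auto simp: Pair a_mode_basis a_basis_def lin lookup_add lookup_var algebra_simps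
                intro!: poly_mapping_eqI simp: lookup_minus)
        qed
      next
        case False
        then show ?thesis using 6 minus_add[of n "-m"]
          by (auto simp: Pair a_mode_basis a_basis_def lin lookup_add lookup_var)
      qed
    qed (auto simp: Pair a_mode_basis a_basis_def lin algebra_simps)
  qed
qed

text \<open>Free generation: distinct monomials in the creation operators give distinct basis vectors.\<close>

lemma create_ket:
  "foldr (\<lambda>i. a_mode (- int (Suc i))) is (ket \<mu>) =
     basis (\<mu>, \<Sum>i\<leftarrow>is. Poly_Mapping.single i 1)"
  by (induction "is") (simp_all add: ket_def a_mode_basis a_basis_def var_def add.commute nat_add_distrib)

text \<open>The coefficients of a vertex operator are well defined: the sum over \<open>(k, l)\<close> is finite.\<close>

definition mono_deg :: "(nat \<Rightarrow>\<^sub>0 nat) \<Rightarrow> nat" where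
  "mono_deg m = (\<Sum>i\<in>Poly_Mapping.keys m. Suc i * Poly_Mapping.lookup m i)"

lemma mono_deg_superset:
  assumes "finite A" "Poly_Mapping.keys m \<subseteq> A"
  shows "mono_deg m = (\<Sum>i\<in>A. Suc i * Poly_Mapping.lookup m i)"
  unfolding mono_deg_def using assms
  by (intro sum.mono_neutral_left) (auto simp: in_keys_iff)

lemma mono_deg_add: "mono_deg (m + m') = mono_deg m + mono_deg m'"
proof -
  let ?A = "Poly_Mapping.keys m \<union> Poly_Mapping.keys m'"
  have "Poly_Mapping.keys (m + m') \<subseteq> ?A" by (rule keys_add)
  then show ?thesis
    by (subst (1 2 3) mono_deg_superset[of ?A])
       (auto simp: lookup_add sum.distrib algebra_simps)
qed

lemma mono_deg_var: "n > 0 \<Longrightarrow> int (mono_deg (var n)) = n"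
  by (simp add: mono_deg_def var_def)

definition bounded_part :: "int \<Rightarrow> real set \<Rightarrow> fock set" where
  "bounded_part d C = {v. \<forall>b\<in>Poly_Mapping.keys v. int (mono_deg (snd b)) \<le> d \<and> fst b \<in> C}"

lemma subspace_bounded_part: "fock.subspace (bounded_part d C)"
proof (rule fock.subspaceI)
  show "0 \<in> bounded_part d C" by (simp add: bounded_part_def)
  show "x + y \<in> bounded_part d C" if "x \<in> bounded_part d C" "y \<in> bounded_part d C" for x y
    using that keys_add[of x y] unfolding bounded_part_def by blast
  show "scl c x \<in> bounded_part d C" if "x \<in> bounded_part d C" for c x
    using that by (auto simp: bounded_part_def in_keys_iff)
qed

lemmas bounded_part_closed =
  fock.subspace_0[OF subspace_bounded_part]
  fock.subspace_add[OF subspace_bounded_part]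
  fock.subspace_scale[OF subspace_bounded_part]
  fock.subspace_sum[OF subspace_bounded_part]

lemma keys_basis [simp]: "Poly_Mapping.keys (basis b) = {b}"
  by (simp add: basis_def)

lemma bounded_part_neg: "d < 0 \<Longrightarrow> v \<in> bounded_part d C \<Longrightarrow> v = 0"
  unfolding bounded_part_def
  by (metis (mono_tags, lifting) all_not_in_conv keys_eq_empty linorder_not_less mem_Collect_eq of_nat_0_le_iff
      order.strict_trans1)

lemma a_mode_bounded_part:
  assumes "v \<in> bounded_part d C"
  shows "a_mode n v \<in> bounded_part (d - n) C"
  unfolding a_mode_def lin_ext_def
proof (rule bounded_part_closed(4), rule bounded_part_closed(3))
  fix b assume "b \<in> Poly_Mapping.keys v"
  then have b: "int (mono_deg (snd b)) \<le> d" "fst b \<in> C"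
    using assms by (auto simp: bounded_part_def)
  obtain \<mu> m where [simp]: "b = (\<mu>, m)" by (cases b)
  consider "n < 0" | "n = 0" | "n > 0" "Poly_Mapping.lookup m (nat n - 1) = 0"
    | "n > 0" "Poly_Mapping.lookup m (nat n - 1) \<noteq> 0" by linarith
  then show "a_basis n b \<in> bounded_part (d - n) C"
  proof cases
    case 1
    then show ?thesis using b mono_deg_var[of "- n"]
      by (simp add: a_basis_def bounded_part_def mono_deg_add)
  next
    case 2
    have "basis b \<in> bounded_part d C" using b by (simp add: bounded_part_def)
    then show ?thesis using 2 by (simp add: a_basis_def bounded_part_closed)
  next
    case 3
    then show ?thesis by (simp add: a_basis_def bounded_part_closed)
  next
    case 4
    then have "m - var n + var n = m"
      by (intro poly_mapping_eqI)
         (auto simp: var_def lookup_add lookup_minus lookup_single when_def)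
    then have "mono_deg m = mono_deg (m - var n) + mono_deg (var n)"
      by (metis mono_deg_add)
    then have "basis (\<mu>, m - var n) \<in> bounded_part (d - n) C"
      using b 4 mono_deg_var[of n] by (simp add: bounded_part_def)
    then show ?thesis using 4 by (simp add: a_basis_def bounded_part_closed)
  qed
qed

definition shifts_degree :: "int \<Rightarrow> op_series \<Rightarrow> bool" where
  "shifts_degree s X \<longleftrightarrow>
     (\<forall>k d C v. v \<in> bounded_part d C \<longrightarrow> X k v \<in> bounded_part (d + s * int k) C)"

lemma shifts_degree_mult:
  assumes "shifts_degree s A" "shifts_degree s B"
  shows "shifts_degree s (series_mult A B)"
  unfolding shifts_degree_def
proof (intro allI impI)
  fix k d C v assume v: "v \<in> bounded_part d C"
  have "A i (B (k - i) v) \<in> bounded_part (d + s * int k) C" if "i \<le> k" for i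
  proof -
    have "B (k - i) v \<in> bounded_part (d + s * int (k - i)) C"
      using assms(2) v by (simp add: shifts_degree_def)
    then have "A i (B (k - i) v) \<in> bounded_part (d + s * int (k - i) + s * int i) C"
      using assms(1) by (simp add: shifts_degree_def)
    moreover have "d + s * int (k - i) + s * int i = d + s * int k"
      using that by (simp add: of_nat_diff algebra_simps)
    ultimately show ?thesis by simp
  qed
  then show "series_mult A B k v \<in> bounded_part (d + s * int k) C"
    by (auto simp: series_mult_def intro!: bounded_part_closed)
qed

lemma shifts_degree_power:
  assumes "shifts_degree s X"
  shows "shifts_degree s (series_power X r)"
proof (induction r)
  case 0
  then show ?case by (auto simp: shifts_degree_def bounded_part_closed)
next
  case (Suc r)
  then show ?case by (simp add: shifts_degree_mult assms)
qed

lemma shifts_degree_exp: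
  assumes "shifts_degree s X"
  shows "shifts_degree s (series_exp X)"
  using shifts_degree_power[OF assms]
  by (auto simp: shifts_degree_def series_exp_def intro!: bounded_part_closed)

lemma shifts_degree_create: "shifts_degree 1 (create_series \<mu>)"
  using a_mode_bounded_part[of _ _ _ "- int k" for k]
  by (auto simp: shifts_degree_def create_series_def intro!: bounded_part_closed(1,3))

lemma shifts_degree_annih: "shifts_degree (-1) (annih_series \<mu>)"
  using a_mode_bounded_part[of _ _ _ "int k" for k]
  by (auto simp: shifts_degree_def annih_series_def simp del: fock.scale_minus_left
      intro!: bounded_part_closed(1,3))

lemma vertex_coeff_finite: "finite {kl. vertex_term \<mu> p v kl \<noteq> 0}"
proof -
  define C where "C = fst ` Poly_Mapping.keys v"
  define d where "d = (\<Sum>b\<in>Poly_Mapping.keys v. mono_deg (snd b))"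
  have v: "v \<in> bounded_part (int d) C"
  proof -
    have "mono_deg (snd b) \<le> d" if "b \<in> Poly_Mapping.keys v" for b
      unfolding d_def using that by (intro member_le_sum) auto
    then show ?thesis by (auto simp: bounded_part_def C_def)
  qed
  have "kl \<in> (\<Union>c\<in>C. \<Union>l\<le>d. {(nat \<lfloor>p + real l - \<mu> * c\<rfloor>, l)})"
    if nz: "vertex_term \<mu> p v kl \<noteq> 0" for kl
  proof -
    obtain k l where kl: "kl = (k, l)" by (cases kl)
    define w where "w = series_exp (annih_series \<mu>) l v"
    define u where "u = series_exp (create_series \<mu>) k w"
    have w: "w \<in> bounded_part (int d - int l) C"
      using v shifts_degree_exp[OF shifts_degree_annih[of \<mu>]]
      unfolding w_def shifts_degree_def by fastforce
    then have u: "u \<in> bounded_part (int d - int l + int k) C"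
      using shifts_degree_exp[OF shifts_degree_create[of \<mu>]]
      unfolding u_def shifts_degree_def by fastforce
    have zu: "z_pow \<mu> (p - real k + real l) u \<noteq> 0"
      using nz linear_opD(3)[OF linear_exp_q] by (auto simp: kl vertex_term_def w_def u_def)
    have "w \<noteq> 0"
    proof
      assume "w = 0"
      then have "w \<in> bounded_part (-1 - int k) C" by (simp add: bounded_part_closed)
      then have "u \<in> bounded_part (-1 - int k + 1 * int k) C"
        using shifts_degree_exp[OF shifts_degree_create[of \<mu>]]
        unfolding u_def shifts_degree_def by blast
      then have "u = 0" using bounded_part_neg by force
      then show False using zu by (simp add: z_pow_def linear_opD(3)[OF linear_lin_ext])
    qed
    then have l: "l \<le> d"
      using w bounded_part_neg[of "int d - int l" w C] by linarith
    obtain b where b: "b \<in> Poly_Mapping.keys u" "\<mu> * fst b = p - real k + real l"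
    proof -
      have "\<exists>b\<in>Poly_Mapping.keys u. \<mu> * fst b = p - real k + real l"
      proof (rule ccontr)
        assume "\<not> ?thesis"
        then have "z_pow \<mu> (p - real k + real l) u = 0"
          unfolding z_pow_def lin_ext_def by (intro sum.neutral) auto
        then show False using zu by simp
      qed
      then show ?thesis using that by blast
    qed
    have "fst b \<in> C" using b(1) u by (auto simp: bounded_part_def)
    moreover have "p + real l - \<mu> * fst b = real k" using b(2) by simp
    then have "nat \<lfloor>p + real l - \<mu> * fst b\<rfloor> = k" by simp
    ultimately show ?thesis using l by (auto simp: kl)
  qed
  then have "{kl. vertex_term \<mu> p v kl \<noteq> 0} \<subseteq> (\<Union>c\<in>C. \<Union>l\<le>d. {(nat \<lfloor>p + real l - \<mu> * c\<rfloor>, l)})"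
    by blast
  moreover have "finite C" by (simp add: C_def)
  ultimately show ?thesis by (auto intro: finite_subset)
qed

end

theory Submission
  imports Defs
begin

text \<open>
  Write \<open>\<mu>\<close> for the generator of the lattice and \<open>S\<^sub>n\<close> for the coefficients of the creation
  exponential of the vertex operator. Applied to a ket, the vertex operator yields \<open>S\<^sub>n\<close> on the
  next ket; the case \<open>n = 0\<close> makes the spaces \<open>W\<^sub>j\<close> increase as \<open>j\<close> decreases, so their union \<open>W\<close>
  is a subspace. Since \<open>[a\<^sub>n, V(z)] = \<mu> z\<^sup>n V(z)\<close>, an \<open>a\<^sub>-\<^sub>n\<close> that maps all kets into \<open>W\<close>
  preserves \<open>W\<close>. Now \<open>S\<^sub>n\<close> is \<open>\<mu> a\<^sub>-\<^sub>n / n\<close> plus a polynomial in the \<open>a\<^sub>-\<^sub>m\<close> with \<open>m < n\<close>, so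
  induction on \<open>n\<close> shows that all \<open>a\<^sub>-\<^sub>n\<close> preserve \<open>W\<close>. The kets generate everything under these.
\<close>

section \<open>Series of operators\<close>

lemma linear_span_closed:
  assumes "linear_op f" "fock.subspace T" "\<And>x. x \<in> S \<Longrightarrow> f x \<in> T" "v \<in> fock.span S"
  shows "f v \<in> T"
  using assms(4)
proof (induction rule: fock.span_induct)
  case base
  show ?case
    using assms(2) by (intro fock.subspaceI)
      (auto simp: linear_opD[OF assms(1)] fock.subspace_0 fock.subspace_add fock.subspace_scale)
next
  case (step x)
  then show ?case by (rule assms(3))
qed

lemma linear_series_power:
  assumes "\<And>k. linear_op (X k)"
  shows "linear_op (series_power X r k)"
proof (induction r arbitrary: k)
  case 0
  show ?case by (rule linear_opI) simp_all
next
  case (Suc r)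
  note lin = linear_opD[OF assms] linear_opD[OF Suc]
  show ?case
    by (rule linear_opI)
      (simp_all add: series_mult_def lin sum.distrib fock.scale_sum_right)
qed

lemma linear_series_exp:
  assumes "\<And>k. linear_op (X k)"
  shows "linear_op (series_exp X k)"
  by (rule linear_opI)
    (simp_all add: series_exp_def linear_opD[OF linear_series_power[OF assms]] sum.distrib
      fock.scale_sum_right fock.scale_right_distrib mult.commute)

text \<open>Without a constant term, every factor of the power contributes degree at least
  one.\<close>

lemma series_power_eq_0:
  assumes "\<And>k. linear_op (X k)" "\<And>v. X 0 v = 0" "k < r"
  shows "series_power X r k v = 0"
  using assms(3)
proof (induction r arbitrary: k)
  case (Suc r)
  have "X i (series_power X r (k - i) v) = 0" if "i \<le> k" for i
    using Suc that by (cases "i = 0") (auto simp: assms(2) linear_opD(3)[OF assms(1)])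
  then show ?case by (simp add: series_mult_def)
qed simp

text \<open>The extra powers vanish in degree \<open>k\<close>. This allows exponentials in
  different degrees to be written with one common truncation.\<close>

lemma series_exp_atMost:
  assumes "\<And>k. linear_op (X k)" "\<And>v. X 0 v = 0" "k \<le> n"
  shows "series_exp X k v = (\<Sum>r\<le>n. scl (1 / fact r) (series_power X r k v))"
  unfolding series_exp_def using assms
  by (intro sum.mono_neutral_left) (auto simp: series_power_eq_0)

lemma series_exp_0: "series_exp X 0 v = v"
  by (simp add: series_exp_def)

text \<open>Leibniz rule for \<open>[D, X(z)] = c z^m\<close>: the commutator is a scalar, so it
  moves past all factors and each of the \<open>Suc r\<close> positions contributes
  \<open>c z^m X(z)^r\<close>.\<close>

lemma series_power_commutator:
  assumes lin: "linear_op D" "\<And>k. linear_op (X k)"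
    and comm: "\<And>k v. D (X k v) = X k (D v) + (if k = m then scl c v else 0)"
  shows "D (series_power X (Suc r) k v) = series_power X (Suc r) k (D v)
    + (if m \<le> k then scl (of_nat (Suc r) * c) (series_power X r (k - m) v) else 0)"
proof (induction r arbitrary: k)
  case 0
  have "series_power X (Suc 0) k w = X k w" for k w
  proof -
    have "series_power X (Suc 0) k w = (\<Sum>i\<le>k. if i = k then X i w else 0)"
      unfolding series_power.simps series_mult_def
      by (intro sum.cong) (auto simp: linear_opD(3)[OF lin(2)])
    then show ?thesis by simp
  qed
  then show ?case by (simp add: comm)
next
  case (Suc r)
  let ?P = "series_power X"
  \<comment> \<open>\<open>R i\<close> is what the induction hypothesis leaves behind once
    \<open>D\<close> has passed the first factor \<open>X i\<close> and moves through the remaining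
    \<open>Suc r\<close> factors.\<close>
  define R where "R i = (if m \<le> k - i then scl (of_nat (Suc r) * c) (X i (?P r (k - i - m) v)) else 0)" for i
  have "D (?P (Suc (Suc r)) k v) = (\<Sum>i\<le>k. D (X i (?P (Suc r) (k - i) v)))"
    by (simp add: series_mult_def linear_opD[OF lin(1)] del: series_power.simps(2)
        add: series_power.simps(2)[of _ "Suc r"])
  also have "\<dots> = (\<Sum>i\<le>k. X i (?P (Suc r) (k - i) (D v)) + R i
      + (if i = m then scl c (?P (Suc r) (k - i) v) else 0))"
    by (intro sum.cong refl)
      (simp add: comm Suc R_def linear_opD[OF lin(2)] del: series_power.simps)
  also have "\<dots> = ?P (Suc (Suc r)) k (D v) + (\<Sum>i\<le>k. R i)
      + (if m \<le> k then scl c (?P (Suc r) (k - m) v) else 0)"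
    by (simp add: sum.distrib series_mult_def del: series_power.simps(2)
        add: series_power.simps(2)[of _ "Suc r"])
  also have "(\<Sum>i\<le>k. R i) = (if m \<le> k then scl (of_nat (Suc r) * c) (?P (Suc r) (k - m) v) else 0)"
  proof (cases "m \<le> k")
    case True
    \<comment> \<open>Only the indices \<open>i \<le> k - m\<close> contribute, and they form the
      Cauchy product of \<open>X\<close> with its \<open>r\<close>-th power in degree
      \<open>k - m\<close>.\<close>
    have "(\<Sum>i\<le>k. R i) = (\<Sum>i\<le>k - m. R i)"
      using True by (intro sum.mono_neutral_right) (auto simp: R_def)
    also have "\<dots> = (\<Sum>i\<le>k - m. scl (of_nat (Suc r) * c) (X i (?P r (k - m - i) v)))"
      using True by (intro sum.cong) (auto simp: R_def add.commute)
    finally show ?thesis using True by (simp add: series_mult_def fock.scale_sum_right)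
  qed (auto simp: R_def intro!: sum.neutral)
  also have "?P (Suc (Suc r)) k (D v)
      + (if m \<le> k then scl (of_nat (Suc r) * c) (?P (Suc r) (k - m) v) else 0)
      + (if m \<le> k then scl c (?P (Suc r) (k - m) v) else 0)
    = ?P (Suc (Suc r)) k (D v)
      + (if m \<le> k then scl (of_nat (Suc (Suc r)) * c) (?P (Suc r) (k - m) v) else 0)"
    unfolding of_nat_Suc[of "Suc r"] distrib_right fock.scale_left_distrib by simp
  finally show ?case .
qed

text \<open>The Leibniz factor \<open>Suc r\<close> turns \<open>1 / fact (Suc r)\<close> into
  \<open>1 / fact r\<close>, so the commutator is again an exponential:
  \<open>[D, exp X(z)] = c z^m exp X(z)\<close>.\<close>

lemma series_exp_commutator:
  assumes lin: "linear_op D" "\<And>k. linear_op (X k)"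
    and X0: "\<And>v. X 0 v = 0" and m: "m > 0"
    and comm: "\<And>k v. D (X k v) = X k (D v) + (if k = m then scl c v else 0)"
  shows "D (series_exp X k v) = series_exp X k (D v)
    + (if m \<le> k then scl c (series_exp X (k - m) v) else 0)"
proof (cases k)
  case 0
  then show ?thesis using m by (simp add: series_exp_0)
next
  case (Suc k')
  let ?P = "series_power X"
  \<comment> \<open>The zeroth power lives in degree 0 only, so in positive degree the sum starts
    with the first power, as the Leibniz rule requires.\<close>
  have split: "series_exp X k w = (\<Sum>r\<le>k'. scl (1 / fact (Suc r)) (?P (Suc r) k w))" for w
    unfolding series_exp_def Suc by (subst sum.atMost_Suc_shift) simp
  have "D (series_exp X k v) = (\<Sum>r\<le>k'. scl (1 / fact (Suc r)) (D (?P (Suc r) k v)))"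
    by (simp add: split linear_opD[OF lin(1)] del: series_power.simps)
  also have "\<dots> = (\<Sum>r\<le>k'. scl (1 / fact (Suc r)) (?P (Suc r) k (D v))
      + (if m \<le> k then scl c (scl (1 / fact r) (?P r (k - m) v)) else 0))"
  proof (intro sum.cong refl)
    fix r
    have "1 / fact (Suc r) * (of_nat (Suc r) * c) = c * (1 / fact r :: complex)"
      by (simp add: field_simps del: of_nat_Suc)
    then show "scl (1 / fact (Suc r)) (D (?P (Suc r) k v)) = scl (1 / fact (Suc r)) (?P (Suc r) k (D v))
      + (if m \<le> k then scl c (scl (1 / fact r) (?P r (k - m) v)) else 0)"
      unfolding series_power_commutator[OF lin comm]
      by (simp add: fock.scale_right_distrib del: series_power.simps fact_Suc of_nat_Suc)
  qed
  also have "\<dots> = series_exp X k (D v) + (if m \<le> k then scl c (series_exp X (k - m) v) else 0)"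
  proof -
    \<comment> \<open>Here \<open>m > 0\<close> gives \<open>k - m \<le> k'\<close>, so truncating
      at \<open>k'\<close> loses nothing.\<close>
    have "series_exp X (k - m) v = (\<Sum>r\<le>k'. scl (1 / fact r) (?P r (k - m) v))"
      using m Suc by (intro series_exp_atMost lin X0) auto
    then show ?thesis
      unfolding sum.distrib split[symmetric] by (simp only: fock.scale_sum_right) simp
  qed
  finally show ?thesis .
qed

lemma series_exp_commute:
  assumes "linear_op D" "\<And>k. linear_op (X k)" "\<And>v. X 0 v = 0" "\<And>k v. D (X k v) = X k (D v)"
  shows "D (series_exp X k v) = series_exp X k (D v)"
  using series_exp_commutator[of D X 1 0 k v, OF assms(1-3)] assms(4) by simp


section \<open>Commutators with vertex operators\<close>

lemma linear_create_series: "linear_op (create_series \<mu> k)"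
  by (rule linear_opI)
    (simp_all add: create_series_def linear_opD[OF linear_a_mode] fock.scale_right_distrib mult.commute)

lemma linear_annih_series: "linear_op (annih_series \<mu> k)"
  by (rule linear_opI)
    (simp_all add: annih_series_def linear_opD[OF linear_a_mode] fock.scale_right_distrib mult.commute
      del: fock.scale_minus_left)

lemma linear_z_pow: "linear_op (z_pow \<mu> p)"
  by (simp add: z_pow_def linear_lin_ext)

lemma create_series_0: "create_series \<mu> 0 v = 0"
  by (simp add: create_series_def)

lemma annih_series_0: "annih_series \<mu> 0 v = 0"
  by (simp add: annih_series_def)

lemma z_pow_commute: "z_pow \<mu> p (a_mode n v) = a_mode n (z_pow \<mu> p v)"
proof (rule linear_op_eqI[of "\<lambda>v. z_pow \<mu> p (a_mode n v)" "\<lambda>v. a_mode n (z_pow \<mu> p v)"])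
  show "linear_op (\<lambda>v. z_pow \<mu> p (a_mode n v))" "linear_op (\<lambda>v. a_mode n (z_pow \<mu> p v))"
    by (rule linear_opI; simp add: linear_opD[OF linear_z_pow] linear_opD[OF linear_a_mode])+
  show "z_pow \<mu> p (a_mode n (basis b)) = a_mode n (z_pow \<mu> p (basis b))" for b
    by (cases b) (simp add: a_mode_basis a_basis_def z_pow_def linear_opD[OF linear_lin_ext]
        linear_opD[OF linear_a_mode])
qed

lemma exp_q_create_exp:
  "exp_q \<mu> (series_exp (create_series \<nu>) k v) = series_exp (create_series \<nu>) k (exp_q \<mu> v)"
  by (intro series_exp_commute linear_exp_q linear_create_series create_series_0)
    (simp add: create_series_def exp_q_commute linear_opD[OF linear_exp_q])

lemma a_mode_create_exp:
  assumes "n < 0"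
  shows "a_mode n (series_exp (create_series \<mu>) k v) = series_exp (create_series \<mu>) k (a_mode n v)"
proof -
  have "a_mode n (a_mode (- int k) v) = a_mode (- int k) (a_mode n v)" for k v
    using heisenberg_relation[of n "- int k" v] assms by simp
  then show ?thesis
    by (intro series_exp_commute linear_a_mode linear_create_series create_series_0)
      (simp add: create_series_def linear_opD[OF linear_a_mode])
qed

text \<open>The mode \<open>a_(-m)\<close> fails to commute only with the \<open>m\<close>-th
  coefficient of the exponent, and there the commutator is the scalar
  \<open>(-\<mu>/m) * (-m) = \<mu>\<close>.\<close>

lemma a_mode_annih_exp:
  assumes m: "m > 0"
  shows "a_mode (- int m) (series_exp (annih_series \<mu>) k v) =
    series_exp (annih_series \<mu>) k (a_mode (- int m) v)
    + (if m \<le> k then scl (of_real \<mu>) (series_exp (annih_series \<mu>) (k - m) v) else 0)"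
proof (rule series_exp_commutator[where X = "annih_series \<mu>", OF linear_a_mode linear_annih_series annih_series_0 m])
  fix k v
  have "a_mode (- int m) (a_mode (int k) v) = a_mode (int k) (a_mode (- int m) v)
      + (if k = m then scl (- of_nat m) v else 0)"
    using heisenberg_relation[of "- int m" "int k" v] by (auto simp: algebra_simps)
  then show "a_mode (- int m) (annih_series \<mu> k v) = annih_series \<mu> k (a_mode (- int m) v)
      + (if k = m then scl (of_real \<mu>) v else 0)"
    using m by (cases "k = m")
      (simp_all add: annih_series_def linear_opD[OF linear_a_mode] fock.scale_right_distrib
        del: fock.scale_minus_left)
qed

section \<open>Linearity of vertex operators and their commutators with creation modes\<close>

lemma linear_vertex_term: "linear_op (\<lambda>v. vertex_term \<mu> p v kl)"
  by (cases kl, rule linear_opI)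
    (simp_all add: vertex_term_def linear_opD[OF linear_exp_q] linear_opD[OF linear_z_pow]
      linear_opD[OF linear_series_exp[OF linear_create_series]]
      linear_opD[OF linear_series_exp[OF linear_annih_series]])

lemma vertex_coeff_superset:
  assumes "finite A" "{kl. vertex_term \<mu> p v kl \<noteq> 0} \<subseteq> A"
  shows "vertex_coeff \<mu> p v = sum (vertex_term \<mu> p v) A"
  unfolding vertex_coeff_def using assms by (rule Sum_any.expand_superset)

lemma linear_vertex_coeff: "linear_op (vertex_coeff \<mu> p)"
proof (rule linear_opI)
  fix x y c
  let ?S = "\<lambda>v. {kl. vertex_term \<mu> p v kl \<noteq> 0}"
  show "vertex_coeff \<mu> p (x + y) = vertex_coeff \<mu> p x + vertex_coeff \<mu> p y"
    by (subst (1 2 3) vertex_coeff_superset[of "?S x \<union> ?S y"])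
      (auto simp: vertex_coeff_finite linear_opD[OF linear_vertex_term] sum.distrib)
  show "vertex_coeff \<mu> p (scl c x) = scl c (vertex_coeff \<mu> p x)"
    by (subst (1 2) vertex_coeff_superset[of "?S x"])
      (auto simp: vertex_coeff_finite linear_opD[OF linear_vertex_term] fock.scale_sum_right)
qed

text \<open>Coefficient form of \<open>[a_(-m), V(z)] = \<mu> z^(-m) V(z)\<close>. All factors
  except the annihilation exponential commute with \<open>a_(-m)\<close>.\<close>

lemma a_mode_vertex_coeff:
  assumes m: "m > 0"
  shows "a_mode (- int m) (vertex_coeff \<mu> p v) =
    vertex_coeff \<mu> p (a_mode (- int m) v) + scl (of_real \<mu>) (vertex_coeff \<mu> (p + real m) v)"
proof -
  let ?a = "a_mode (- int m)" and ?T = "vertex_term \<mu>"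
  \<comment> \<open>The correction terms carry annihilation degree \<open>l - m\<close>. Since
    \<open>p + m - k + (l - m) = p - k + l\<close>, they are the terms of the coefficient at
    \<open>p + m\<close>, reindexed by \<open>l\<close> to \<open>l + m\<close>.\<close>
  let ?sh = "\<lambda>(k, l). (k, l + m) :: nat \<times> nat"
  define B where "B = {kl. ?T (p + real m) v kl \<noteq> 0}"
  \<comment> \<open>One finite index set that supports all three sums.\<close>
  define A where "A = {kl. ?T p v kl \<noteq> 0} \<union> {kl. ?T p (?a v) kl \<noteq> 0} \<union> ?sh ` B"
  define g where "g = (\<lambda>(k, l). if m \<le> l then ?T (p + real m) v (k, l - m) else 0)"
  have fin: "finite A" "finite B" by (simp_all add: A_def B_def vertex_coeff_finite)
  have T_eq: "?a (?T p v kl) = ?T p (?a v) kl + scl (of_real \<mu>) (g kl)" for kl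
  proof -
    obtain k l where kl: "kl = (k, l)" by (cases kl)
    have "p + real m - real k + real (l - m) = p - real k + real l" if "m \<le> l"
      using that by simp
    then have "g kl = (if m \<le> l then exp_q \<mu> (z_pow \<mu> (p - real k + real l)
        (series_exp (create_series \<mu>) k (series_exp (annih_series \<mu>) (l - m) v))) else 0)"
      by (cases "m \<le> l") (simp_all only: kl g_def vertex_term_def prod.case if_True if_False)
    then show ?thesis using m
      by (simp add: kl vertex_term_def exp_q_commute[symmetric] z_pow_commute[symmetric]
          a_mode_create_exp a_mode_annih_exp linear_opD[OF linear_exp_q] linear_opD[OF linear_z_pow]
          linear_opD[OF linear_series_exp[OF linear_create_series]])
  qed
  have "sum g A = sum g (?sh ` B)"
  proof (rule sum.mono_neutral_right)
    show "\<forall>kl\<in>A - ?sh ` B. g kl = 0"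
    proof
      fix kl assume kl: "kl \<in> A - ?sh ` B"
      obtain k l where [simp]: "kl = (k, l)" by (cases kl)
      show "g kl = 0"
      proof (cases "m \<le> l")
        case True
        then have "(k, l - m) \<notin> B" using kl by force
        then show ?thesis using True by (simp add: g_def B_def)
      qed (simp add: g_def)
    qed
  qed (simp_all add: fin, simp add: A_def)
  also have "\<dots> = sum (?T (p + real m) v) B"
    by (subst sum.reindex) (auto simp: inj_on_def g_def intro!: sum.cong)
  also have "\<dots> = vertex_coeff \<mu> (p + real m) v"
    by (rule vertex_coeff_superset[symmetric]) (auto simp: B_def vertex_coeff_finite)
  finally have g: "sum g A = vertex_coeff \<mu> (p + real m) v" .
  have "vertex_coeff \<mu> p v = sum (?T p v) A"
    by (intro vertex_coeff_superset fin(1)) (auto simp: A_def)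
  then have "?a (vertex_coeff \<mu> p v) = (\<Sum>kl\<in>A. ?a (?T p v kl))"
    by (simp add: linear_opD[OF linear_a_mode])
  also have "\<dots> = sum (?T p (?a v)) A + scl (of_real \<mu>) (sum g A)"
    by (simp add: T_eq sum.distrib fock.scale_sum_right)
  also have "sum (?T p (?a v)) A = vertex_coeff \<mu> p (?a v)"
    by (intro vertex_coeff_superset[symmetric] fin(1)) (auto simp: A_def)
  finally show ?thesis by (simp add: g)
qed

lemma annih_exp_ket:
  assumes "k > 0"
  shows "series_exp (annih_series \<mu>) k (ket \<nu>) = 0"
proof -
  have *: "annih_series \<mu> i (ket \<nu>) = 0" for i
    by (simp add: annih_series_def a_mode_pos_ket)
  \<comment> \<open>The alternative \<open>r > 0\<close> is included for the summand
    \<open>i = k\<close>, where the remaining power has degree 0.\<close>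
  have "series_power (annih_series \<mu>) r k (ket \<nu>) = 0" if "k > 0 \<or> r > 0" for r k
    using that
  proof (induction r arbitrary: k)
    case (Suc r)
    have "annih_series \<mu> i (series_power (annih_series \<mu>) r (k - i) (ket \<nu>)) = 0" if "i \<le> k" for i
      using Suc.IH[of "k - i"] * by (cases r; cases "i = k") (auto simp: linear_opD(3)[OF linear_annih_series])
    then show ?case by (simp add: series_mult_def)
  qed simp
  then show ?thesis using assms by (simp add: series_exp_def)
qed


section \<open>Charges\<close>

text \<open>Finite support bounds the degree of any vector. Hence the earlier results on
  \<open>bounded_part\<close> also show that operators preserve charge.\<close>

lemma Fock_iff_bounded_part: "v \<in> Fock \<nu> \<longleftrightarrow> (\<exists>d. v \<in> bounded_part d {\<nu>})"
proof
  assume v: "v \<in> Fock \<nu>"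
  have "mono_deg (snd b) \<le> (\<Sum>b\<in>Poly_Mapping.keys v. mono_deg (snd b))"
    if "b \<in> Poly_Mapping.keys v" for b
    using that by (intro member_le_sum) auto
  then have "v \<in> bounded_part (int (\<Sum>b\<in>Poly_Mapping.keys v. mono_deg (snd b))) {\<nu>}"
    using v by (auto simp: bounded_part_def Fock_def simp del: of_nat_sum)
  then show "\<exists>d. v \<in> bounded_part d {\<nu>}" ..
qed (auto simp: bounded_part_def Fock_def)

lemma subspace_Fock: "fock.subspace (Fock \<nu>)"
proof (rule fock.subspaceI)
  show "x + y \<in> Fock \<nu>" if "x \<in> Fock \<nu>" "y \<in> Fock \<nu>" for x y
    using that keys_add[of x y] unfolding Fock_def by blast
qed (auto simp: Fock_def in_keys_iff)

lemma ket_Fock: "ket \<nu> \<in> Fock \<nu>"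
  by (simp add: Fock_def ket_def)

lemma a_mode_Fock: "v \<in> Fock \<nu> \<Longrightarrow> a_mode n v \<in> Fock \<nu>"
  unfolding Fock_iff_bounded_part using a_mode_bounded_part by blast

lemma shifts_degree_Fock: "shifts_degree s X \<Longrightarrow> v \<in> Fock \<nu> \<Longrightarrow> X k v \<in> Fock \<nu>"
  unfolding Fock_iff_bounded_part shifts_degree_def by blast

lemma z_pow_Fock:
  assumes "v \<in> Fock \<nu>"
  shows "z_pow \<mu> p v = (if \<mu> * \<nu> = p then v else 0)"
proof (cases "\<mu> * \<nu> = p")
  case True
  have "z_pow \<mu> p v = (\<Sum>b\<in>Poly_Mapping.keys v. scl (Poly_Mapping.lookup v b) (basis b))"
    unfolding z_pow_def lin_ext_def using assms True
    by (intro sum.cong) (auto simp: Fock_def)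
  then show ?thesis using True fock_expand[of v] by simp
next
  case False
  then show ?thesis
    unfolding z_pow_def lin_ext_def using assms by (auto simp: Fock_def intro!: sum.neutral)
qed

lemma exp_q_Fock:
  assumes "v \<in> Fock \<nu>"
  shows "exp_q \<mu> v \<in> Fock (\<nu> + \<mu>)"
  unfolding exp_q_def lin_ext_def
proof (rule fock.subspace_sum[OF subspace_Fock], rule fock.subspace_scale[OF subspace_Fock])
  fix b assume "b \<in> Poly_Mapping.keys v"
  then have "fst b = \<nu>" using assms by (simp add: Fock_def)
  then show "(case b of (\<kappa>, m) \<Rightarrow> basis (\<kappa> + \<mu>, m)) \<in> Fock (\<nu> + \<mu>)"
    by (simp add: Fock_def split_beta)
qed

section \<open>Vertex operators on a single Fock module\<close>

lemma vertex_term_Fock: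
  assumes "v \<in> Fock \<nu>"
  shows "vertex_term \<mu> p v (k, l) = (if \<mu> * \<nu> = p - real k + real l
    then exp_q \<mu> (series_exp (create_series \<mu>) k (series_exp (annih_series \<mu>) l v)) else 0)"
    (is ?eq)
    and "vertex_term \<mu> p v (k, l) \<in> Fock (\<nu> + \<mu>)" (is ?mem)
proof -
  have *: "series_exp (create_series \<mu>) k (series_exp (annih_series \<mu>) l v) \<in> Fock \<nu>"
    by (intro shifts_degree_Fock[OF shifts_degree_exp[OF shifts_degree_create]]
        shifts_degree_Fock[OF shifts_degree_exp[OF shifts_degree_annih]] assms)
  show ?eq
    by (simp add: vertex_term_def z_pow_Fock[OF *] linear_opD(3)[OF linear_exp_q])
  then show ?mem
    using exp_q_Fock[OF *] fock.subspace_0[OF subspace_Fock] by simp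
qed

lemma vertex_coeff_Fock:
  assumes "v \<in> Fock \<nu>"
  shows "vertex_coeff \<mu> p v \<in> Fock (\<nu> + \<mu>)"
  unfolding vertex_coeff_def Sum_any.expand_set
proof (rule fock.subspace_sum[OF subspace_Fock])
  show "vertex_term \<mu> p v kl \<in> Fock (\<nu> + \<mu>)" for kl
    using vertex_term_Fock(2)[OF assms] by (cases kl) simp
qed

text \<open>Annihilation modes kill a ket, so only \<open>l = 0\<close> survives; the charge then
  contributes \<open>z^(\<mu> * \<nu>)\<close>, which leaves a single creation degree.\<close>

lemma vertex_coeff_ket:
  "vertex_coeff \<mu> (\<mu> * \<nu> + real k) (ket \<nu>) = series_exp (create_series \<mu>) k (ket (\<nu> + \<mu>))"
proof -
  let ?T = "vertex_term \<mu> (\<mu> * \<nu> + real k) (ket \<nu>)"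
  have "?T (k', l) = 0" if "(k', l) \<noteq> (k, 0)" for k' l
    using that
    by (cases "l = 0")
      (auto simp: vertex_term_Fock[OF ket_Fock] annih_exp_ket linear_opD(3)[OF linear_exp_q]
        linear_opD(3)[OF linear_series_exp[OF linear_create_series]])
  then have "{kl. ?T kl \<noteq> 0} \<subseteq> {(k, 0)}" by force
  then have "vertex_coeff \<mu> (\<mu> * \<nu> + real k) (ket \<nu>) = sum ?T {(k, 0)}"
    by (intro vertex_coeff_superset) simp_all
  then show ?thesis
    by (simp add: vertex_term_Fock[OF ket_Fock] series_exp_0 exp_q_create_exp exp_q_ket)
qed

section \<open>Heisenberg invariance of the lattice space\<close>

lemma subspace_lattice_space: "fock.subspace (lattice_space M)"
  by (simp add: lattice_space_def)

lemma Fock_lattice_space: "Fock (of_int j * sqrt (of_nat M)) \<subseteq> lattice_space M"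
  unfolding lattice_space_def by (rule subset_trans[OF _ fock.span_superset]) blast

lemma a_mode_lattice_space:
  assumes "v \<in> lattice_space M"
  shows "a_mode n v \<in> lattice_space M"
proof (rule linear_span_closed[OF linear_a_mode subspace_lattice_space])
  show "v \<in> fock.span (\<Union>j::int. Fock (of_int j * sqrt (of_nat M)))"
    using assms by (simp add: lattice_space_def)
  show "a_mode n x \<in> lattice_space M" if "x \<in> (\<Union>j::int. Fock (of_int j * sqrt (of_nat M)))" for x
    using that a_mode_Fock Fock_lattice_space by blast
qed


section \<open>The basic subspaces exhaust the lattice space\<close>

text \<open>The shift \<open>c\<close> is \<open>N\<close> for the modes of \<open>e\<close> and \<open>0\<close> for those of \<open>\<theta>\<close>.\<close>

locale vertex_modes =
  fixes \<mu> :: real and M :: nat and c :: int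
  assumes \<mu>_eq: "\<mu> = sqrt (of_nat M)" and M_pos: "M > 0"
begin

definition E :: "int \<Rightarrow> fock \<Rightarrow> fock" where
  "E n = vertex_coeff \<mu> (of_int (- n - c))"

definition G :: "int \<Rightarrow> fock set" where
  "G j = generated E (ket (of_int j * \<mu>))"

definition W :: "fock set" where
  "W = (\<Union>j. G j)"

lemma \<mu>_square: "\<mu> * \<mu> = of_nat M"
  by (simp add: \<mu>_eq)

lemma \<mu>_pos: "\<mu> > 0"
  using M_pos by (simp add: \<mu>_eq)

lemma linear_E: "linear_op (E n)"
  by (simp add: E_def linear_vertex_coeff)

lemma foldr_E_G: "foldr E is (ket (of_int j * \<mu>)) \<in> G j"
  unfolding G_def generated_def by (rule fock.span_base) simp

text \<open>The mode index solves \<open>- n - c = j * M + k\<close>, which is the exponent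
  \<open>\<mu> * (j * \<mu>) + k\<close> because \<open>\<mu> * \<mu> = M\<close>.\<close>

lemma E_ket:
  "E (- (j * int M + int k) - c) (ket (of_int j * \<mu>)) =
    series_exp (create_series \<mu>) k (ket (of_int (j + 1) * \<mu>))"
proof -
  have "real_of_int (- (- (j * int M + int k) - c) - c) = \<mu> * (of_int j * \<mu>) + real k"
    using \<mu>_square by (simp add: mult.left_commute)
  then show ?thesis
    unfolding E_def by (simp only: vertex_coeff_ket) (simp add: algebra_simps)
qed

text \<open>In degree 0 the creation exponential is the identity, so a single mode sends the ket at
  \<open>j - 1\<close> to the ket at \<open>j\<close>.\<close>

lemma G_step: "G j \<subseteq> G (j - 1)"
proof -
  define n where "n = - ((j - 1) * int M + int 0) - c"
  have ket: "ket (of_int j * \<mu>) = E n (ket (of_int (j - 1) * \<mu>))"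
    using E_ket[of "j - 1" 0] by (simp add: n_def series_exp_0)
  have "foldr E is (ket (of_int j * \<mu>)) \<in> G (j - 1)" for "is"
    \<comment> \<open>The last letter of a word acts first, so appending \<open>n\<close> starts
      with the passage between the two kets.\<close>
    using foldr_E_G[of "is @ [n]" "j - 1"] by (simp only: ket foldr_append foldr.simps o_apply id_apply)
  then show ?thesis
    unfolding G_def generated_def by (intro fock.span_minimal) auto
qed

lemma G_antimono: "i \<le> j \<Longrightarrow> G j \<subseteq> G i"
proof (induction i rule: int_le_induct)
  case (step i)
  then show ?case using G_step[of i] by blast
qed simp

lemma subspace_G: "fock.subspace (G j)"
  by (simp add: G_def generated_def)

text \<open>The spaces \<open>G j\<close> form a chain, so any two vectors of the union lie in a
  common member.\<close>

lemma subspace_W: "fock.subspace W"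
proof (rule fock.subspaceI)
  show "0 \<in> W" using fock.subspace_0[OF subspace_G] by (auto simp: W_def)
  show "x + y \<in> W" if xy: "x \<in> W" "y \<in> W" for x y
  proof -
    obtain i j where ij: "x \<in> G i" "y \<in> G j" using xy by (auto simp: W_def)
    then have "x \<in> G (min i j)" "y \<in> G (min i j)"
      using G_antimono[of "min i j" i] G_antimono[of "min i j" j] by auto
    then show ?thesis using fock.subspace_add[OF subspace_G] by (auto simp: W_def)
  qed
  show "scl d x \<in> W" if "x \<in> W" for d x
    using that fock.subspace_scale[OF subspace_G] by (auto simp: W_def)
qed

lemma foldr_E_W: "foldr E is (ket (of_int j * \<mu>)) \<in> W"
  using foldr_E_G by (auto simp: W_def)

section \<open>Closure of \<open>W\<close> under vertex modes and creation modes\<close>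

lemma W_closed:
  assumes "linear_op f" "\<And>is j. f (foldr E is (ket (of_int j * \<mu>))) \<in> W" "v \<in> W"
  shows "f v \<in> W"
proof -
  obtain j where "v \<in> G j" using assms(3) by (auto simp: W_def)
  then show ?thesis
    unfolding G_def generated_def
    by (rule linear_span_closed[OF assms(1) subspace_W, rotated]) (use assms(2) in auto)
qed

lemma E_W: "v \<in> W \<Longrightarrow> E n v \<in> W"
  using foldr_E_W[of "n # is" for "is"] by (simp add: W_closed[OF linear_E])

lemma a_mode_E:
  assumes "m > 0"
  shows "a_mode (- int m) (E n v) = E n (a_mode (- int m) v) + scl (of_real \<mu>) (E (n - int m) v)"
proof -
  have "real_of_int (- n - c) + real m = of_int (- (n - int m) - c)" by simp
  then show ?thesis
    unfolding E_def a_mode_vertex_coeff[OF assms] by (simp only:)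
qed

text \<open>Moving \<open>a_(-m)\<close> through a word produces, at each letter, a correction with
  that letter lowered by \<open>m\<close>, again a word on the same ket.\<close>

lemma a_mode_W:
  assumes "m > 0" "\<And>j. a_mode (- int m) (ket (of_int j * \<mu>)) \<in> W" "v \<in> W"
  shows "a_mode (- int m) v \<in> W"
proof (rule W_closed[OF linear_a_mode _ assms(3)])
  fix "is" j
  show "a_mode (- int m) (foldr E is (ket (of_int j * \<mu>))) \<in> W"
  proof (induction "is")
    case Nil
    then show ?case using assms(2) by simp
  next
    case (Cons n "is")
    then show ?case
      by (simp add: a_mode_E[OF assms(1)] E_W foldr_E_W
          fock.subspace_add[OF subspace_W] fock.subspace_scale[OF subspace_W])
  qed
qed

lemma a_mode_ket_W: "n > 0 \<Longrightarrow> a_mode (- int n) (ket (of_int j * \<mu>)) \<in> W"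
proof (induction n arbitrary: j rule: less_induct)
  case (less n)
  let ?X = "create_series \<mu>" and ?v = "ket (of_int j * \<mu>)"
  let ?P = "series_power ?X"
  have v: "?v \<in> W" using foldr_E_W[of "[]" j] by simp
  \<comment> \<open>The induction hypothesis covers all kets, so the lower creation modes already
    preserve all of \<open>W\<close>; the coefficient at \<open>k = 0\<close> is zero.\<close>
  have X: "?X k w \<in> W" if "w \<in> W" "k < n" for w k
    using that a_mode_W[OF _ less.IH, of k]
    by (auto simp: create_series_def intro!: fock.subspace_0[OF subspace_W] fock.subspace_scale[OF subspace_W])
  have P: "?P r k ?v \<in> W" if "k < n" for r k
    using that
  proof (induction r arbitrary: k)
    case 0
    then show ?case using v by (simp add: fock.subspace_0[OF subspace_W])
  next
    case (Suc r)
    then show ?case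
      by (auto simp: series_mult_def intro!: fock.subspace_sum[OF subspace_W] X)
  qed
  \<comment> \<open>In a product of at least two factors, a leading factor of degree
    \<open>n\<close> meets a positive power in degree 0, which vanishes. Every other nonzero summand
    involves lower modes only.\<close>
  have P2: "?P (Suc (Suc r)) n ?v \<in> W" for r
  proof -
    have "?X i (?P (Suc r) (n - i) ?v) \<in> W" if i: "i \<le> n" for i
    proof -
      consider "i = 0" | "i = n" | "0 < i" "i < n" using i by linarith
      then show ?thesis
      proof cases
        case 1
        then show ?thesis by (simp add: create_series_0 fock.subspace_0[OF subspace_W])
      next
        case 2
        have "?P (Suc r) 0 ?v = 0"
          by (intro series_power_eq_0 linear_create_series create_series_0) simp
        then show ?thesis
          using 2 by (simp add: linear_opD(3)[OF linear_create_series] fock.subspace_0[OF subspace_W]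
              del: series_power.simps)
      next
        case 3
        then show ?thesis by (intro X P) auto
      qed
    qed
    then show ?thesis
      unfolding series_power.simps(2)[of _ "Suc r"] series_mult_def
      by (intro fock.subspace_sum[OF subspace_W]) auto
  qed
  have P1: "?P 1 n ?v = ?X n ?v"
  proof -
    have "?P 1 n ?v = (\<Sum>i\<le>n. if i = n then ?X i ?v else 0)"
      unfolding One_nat_def series_power.simps series_mult_def
      by (intro sum.cong) (auto simp: linear_opD(3)[OF linear_create_series])
    then show ?thesis by simp
  qed
  define R where "R = (\<Sum>r\<in>{..n} - {1}. scl (1 / fact r) (?P r n ?v))"
  have "series_exp ?X n ?v = ?X n ?v + R"
    unfolding series_exp_def R_def using less.prems P1
    by (subst sum.remove[of _ 1]) (auto simp del: series_power.simps)
  \<comment> \<open>This vector is a vertex mode applied to the ket at \<open>j - 1\<close>.\<close>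
  moreover have "series_exp ?X n ?v \<in> W"
    using E_ket[of "j - 1" n] E_W[OF foldr_E_W[of "[]" "j - 1"]] by (simp, metis)
  moreover have "R \<in> W"
    unfolding R_def
  proof (rule fock.subspace_sum[OF subspace_W], rule fock.subspace_scale[OF subspace_W])
    fix r assume r: "r \<in> {..n} - {1}"
    show "?P r n ?v \<in> W"
    proof (cases r)
      case 0
      then show ?thesis using less.prems by (simp add: fock.subspace_0[OF subspace_W])
    next
      case (Suc r')
      then obtain r'' where "r = Suc (Suc r'')" using r by (cases r') auto
      then show ?thesis using P2 by simp
    qed
  qed
  ultimately have "?X n ?v \<in> W"
    using fock.subspace_diff[OF subspace_W, of "?X n ?v + R" R] by simp
  \<comment> \<open>The coefficient of \<open>a_(-n)\<close> in the exponent is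
    \<open>\<mu> / n\<close>, invertible because \<open>\<mu> > 0\<close>.\<close>
  then have "scl (of_nat n / of_real \<mu>) (?X n ?v) \<in> W"
    by (rule fock.subspace_scale[OF subspace_W])
  then show ?case
    using less.prems \<mu>_pos by (simp add: create_series_def)
qed

section \<open>Exhaustion of the lattice space\<close>

lemma basis_W: "basis (of_int j * \<mu>, w) \<in> W"
proof (induction "mono_deg w" arbitrary: w rule: less_induct)
  case less
  show ?case
  proof (cases "w = 0")
    case True
    then show ?thesis using foldr_E_W[of "[]" j] by (simp add: ket_def)
  next
    case False
    then obtain i where i: "Poly_Mapping.lookup w i \<noteq> 0"
      by (metis poly_mapping_eqI lookup_zero)
    \<comment> \<open>Variable \<open>i\<close> stands for the mode \<open>a_(-(i+1))\<close>.
      Removing one such factor lowers the degree by \<open>n\<close>.\<close>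
    define n where "n = Suc i"
    define u where "u = w - var (int n)"
    have w: "w = u + var (int n)"
      using i unfolding u_def n_def
      by (intro poly_mapping_eqI)
        (auto simp: var_def nat_add_distrib lookup_add lookup_minus lookup_single when_def)
    have deg: "mono_deg u < mono_deg w"
      using mono_deg_var[of "int n"] by (simp add: w mono_deg_add n_def)
    have "a_mode (- int n) (basis (of_int j * \<mu>, u)) \<in> W"
      by (rule a_mode_W[OF _ a_mode_ket_W less[OF deg]]) (simp_all add: n_def)
    then show ?thesis by (simp add: a_mode_basis a_basis_def w n_def add.commute)
  qed
qed

lemma W_eq: "W = lattice_space M"
proof
  \<comment> \<open>Every letter raises the charge by \<open>\<mu>\<close>, so words stay in lattice
    charges.\<close>
  have "foldr E is (ket (of_int j * \<mu>)) \<in> Fock (of_int (j + int (length is)) * \<mu>)" for "is" j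
  proof (induction "is")
    case (Cons n "is")
    then show ?case
      using vertex_coeff_Fock[OF Cons] by (simp add: E_def algebra_simps)
  qed (simp add: ket_Fock)
  then have "foldr E is (ket (of_int j * \<mu>)) \<in> lattice_space M" for "is" j
    using Fock_lattice_space \<mu>_eq by blast
  then show "W \<subseteq> lattice_space M"
    unfolding W_def G_def generated_def
    by (intro UN_least fock.span_minimal subspace_lattice_space) auto
  have "v \<in> W" if "v \<in> Fock (of_int j * \<mu>)" for v j
  proof -
    have "basis b \<in> W" if "b \<in> Poly_Mapping.keys v" for b
      using \<open>v \<in> Fock (of_int j * \<mu>)\<close> that basis_W[of j "snd b"] by (cases b) (auto simp: Fock_def)
    then show ?thesis
      by (subst fock_expand)
        (intro fock.subspace_sum[OF subspace_W] fock.subspace_scale[OF subspace_W])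
  qed
  then show "lattice_space M \<subseteq> W"
    unfolding lattice_space_def using \<mu>_eq by (intro fock.span_minimal subspace_W) auto
qed

end

theorem theorem5p1:
  shows "(\<forall>N::nat. N \<ge> 1 \<longrightarrow>
            (\<forall>n::int. a_mode n ` W_even N \<subseteq> W_even N) \<and> W_even N = lattice_space (2 * N))
       \<and> (\<forall>N::nat.
            (\<forall>n::int. a_mode n ` W_odd N \<subseteq> W_odd N) \<and> W_odd N = lattice_space (2 * N + 1))"
proof -
  have even: "W_even N = lattice_space (2 * N)" if "N \<ge> 1" for N
  proof -
    \<comment> \<open>The shift \<open>N\<close> reflects the expansion
      \<open>e(z) = \<Sum> e_n z^(-n-N)\<close>; \<open>N \<ge> 1\<close> makes the lattice
      generator positive.\<close>
    interpret vertex_modes "sqrt (of_nat (2 * N))" "2 * N" "int N"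
      by unfold_locales (use that in auto)
    have "e_mode N = E" by (intro ext) (simp only: e_mode_def E_def)
    then show ?thesis using W_eq by (simp only: W_even_def W_def G_def)
  qed
  have odd: "W_odd N = lattice_space (2 * N + 1)" for N
  proof -
    interpret vertex_modes "sqrt (of_nat (2 * N + 1))" "2 * N + 1" 0
      by unfold_locales auto
    have "theta_mode N = E" by (intro ext) (simp only: theta_mode_def E_def diff_0_right)
    then show ?thesis using W_eq by (simp only: W_odd_def W_def G_def)
  qed
  \<comment> \<open>Invariance under all modes, including \<open>n \<ge> 0\<close>, is read off from
    the equality with the lattice space.\<close>
  show ?thesis
    by (auto simp: even odd a_mode_lattice_space)
qed

end
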